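(* Let $x,y,t,q$ be variables and $X=(x_0,x_1,x_2,\dots)$, $Y=(y_0,y_1,y_2,\dots)$ commutative alphabets. Define the formal power series $$\Phi(t;x,y,X,Y,q)=\sum_{I} t^{\mathrm{size}(I)}\,x^{\mathrm{contacts}(I)}\,y^{\mathrm{rises}(I)}\,\mathrm{ContactMon}(I,X)\,\mathrm{RiseMon}(I,Y)\,q^{\mathrm{dist}(I)},$$ where the sum runs over all intervals $I$ of the Tamari lattices (of all sizes). Then $$\Phi(t;x,y,X,Y,q)=\Phi(t;y,x,Y,X,q),$$ where the right-hand side is obtained by exchanging $x\leftrightarrow y$ and $x_i\leftrightarrow y_i$ for all $i$.
   Context: A Dyck path of size $n$ is a word in $\{1,0\}$ ($1$ = up-step, $0$ = down-step) with $n$ letters of each kind, every prefix having at least as many $1$'s as $0$'s; geometrically a lattice path from $(0,0)$ to $(2n,0)$ staying weakly above $y=0$. The map $\mathrm{tree}$ from Dyck paths to binary trees is: $\mathrm{tree}(\text{empty})=\emptyset$, and writing a nonempty path uniquely as $D=D_1\,1\,D_2\,0$ with $D_1,D_2$ Dyck paths, $\mathrm{tree}(D)$ has left subtree $\mathrm{tree}(D_1)$ and right subtree $\mathrm{tree}(D_2)$. The Tamari order on binary trees of size $n$ is the reflexive-transitive closure of the right rotation replacing a subtree $y(x(A,B),C)$ by $x(A,y(B,C))$ (the result is larger); it is transported to Dyck paths via $\mathrm{tree}$. A Tamari interval of size $n$ is a pair $[D_1,D_2]$ of Dyck paths of size $n$ with $D_1\le D_2$; $\mathrm{size}(I)=n$.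 Statistics of a Dyck path $D$ of size $n$: $\mathrm{contacts}(D)$ is the number of points of the path at height $0$ other than the final point; $\mathrm{rises}(D)$ is the number of initial consecutive up-steps; for $1\le i\le n$, $\mathrm{contacts}_i(D)$ is the number of non-final contacts (points at its base height other than its last point) of the maximal Dyck subpath starting right after the $i$-th up-step (i.e. the part strictly between the $i$-th up-step and its matching down-step); $\mathrm{rises}_i(D)$ is the number of consecutive up-steps immediately following the $i$-th down-step. The contact monomial is $\mathrm{ContactMon}(D,X)=x_{\mathrm{contacts}(D)}\prod_{i=1}^{n-1}x_{\mathrm{contacts}_i(D)}$ and the rise monomial is $\mathrm{RiseMon}(D,Y)=y_{\mathrm{rises}(D)}\prod_{i=1}^{n-1}y_{\mathrm{rises}_i(D)}$. For a Tamari interval $I=[D_1,D_2]$: $\mathrm{contacts}(I)=\mathrm{contacts}(D_1)$, $\mathrm{ContactMon}(I,X)=\mathrm{ContactMon}(D_1,X)$ (lower bound), $\mathrm{rises}(I)=\mathrm{rises}(D_2)$, $\mathrm{RiseMon}(I,Y)=\mathrm{RiseMon}(D_2,Y)$ (upper bound). The distance $\mathrm{dist}(I)$ is the maximal length $k-1$ of a chain $D_1=P_1<P_2<\dots<P_k=D_2$ in the Tamari lattice. *)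

theory Defs
  imports
    "HOL-Library.Tree"
    "HOL-Library.Sublist"
    "HOL-Library.Poly_Mapping"
    "HOL-Computational_Algebra.Formal_Power_Series"
begin

section \<open>Dyck paths\<close>

text \<open>A path is a word over \<^typ>\<open>bool\<close>: \<^term>\<open>True\<close> is an up-step (the letter 1),
  \<^term>\<open>False\<close> a down-step (the letter 0).\<close>

type_synonym path = "bool list"

definition dyck :: "path \<Rightarrow> bool" where
  "dyck D \<longleftrightarrow> count_list D True = count_list D False \<and>
     (\<forall>P. prefix P D \<longrightarrow> count_list P False \<le> count_list P True)"

definition path_size :: "path \<Rightarrow> nat" where
  "path_size D = count_list D True"

definition dyck_paths :: "nat \<Rightarrow> path set" where
  "dyck_paths n = {D. dyck D \<and> path_size D = n}"

lemma count_list_bool_length: "count_list D True + count_list D False = length D"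
  by (induction D) auto

lemma length_dyck_path: "D \<in> dyck_paths n \<Longrightarrow> length D = 2 * n"
  using count_list_bool_length[of D] by (auto simp: dyck_paths_def dyck_def path_size_def)

lemma finite_dyck_paths: "finite (dyck_paths n)"
proof (rule finite_subset)
  show "dyck_paths n \<subseteq> {D. set D \<subseteq> UNIV \<and> length D = 2 * n}"
    using length_dyck_path by auto
qed (rule finite_lists_length_eq, simp)


section \<open>The bijection with binary trees\<close>

definition dyck_split :: "path \<Rightarrow> path \<times> path" where
  "dyck_split D =
     (THE (D\<^sub>1, D\<^sub>2). dyck D\<^sub>1 \<and> dyck D\<^sub>2 \<and> D = D\<^sub>1 @ [True] @ D\<^sub>2 @ [False])"

lemma dyck_prefixD: "dyck (P @ Q) \<Longrightarrow> count_list P False \<le> count_list P True"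
  by (auto simp: dyck_def prefix_def)

lemma dyck_split_unique_aux:
  assumes "dyck A" "dyck B" "dyck C" "dyck D"
    and eq: "A @ [True] @ B @ [False] = C @ [True] @ D @ [False]"
  shows "length C \<le> length A"
proof (rule ccontr)
  assume "\<not> length C \<le> length A"
  then obtain E where E: "C = A @ E" "E \<noteq> []" "[True] @ B @ [False] = E @ [True] @ D @ [False]"
    using eq by (auto simp: append_eq_append_conv2)
  then obtain F where F: "E = True # F" by (cases E) auto
  then have "B @ [False] = (F @ [True] @ D) @ [False]" using E by simp
  then have "B = F @ [True] @ D" by blast
  then have "count_list F False \<le> count_list F True" using assms(2) dyck_prefixD by blast
  moreover have "count_list A True = count_list A False" "count_list C True = count_list C False"
    using assms by (auto simp: dyck_def)
  ultimately show False using E F by simp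
qed

lemma dyck_split_unique:
  assumes "dyck A" "dyck B" "dyck C" "dyck D"
    and eq: "A @ [True] @ B @ [False] = C @ [True] @ D @ [False]"
  shows "A = C \<and> B = D"
proof -
  have "length A = length C"
    using dyck_split_unique_aux[OF assms] dyck_split_unique_aux[OF assms(3,4,1,2) eq[symmetric]]
    by simp
  then show ?thesis using eq by simp
qed

lemma dyck_split_exists:
  assumes D: "dyck D" "D \<noteq> []"
  shows "\<exists>D\<^sub>1 D\<^sub>2. dyck D\<^sub>1 \<and> dyck D\<^sub>2 \<and> D = D\<^sub>1 @ [True] @ D\<^sub>2 @ [False]"
proof -
  define R where "R k \<longleftrightarrow> k < length D \<and> count_list (take k D) True = count_list (take k D) False" for k
  define k where "k = (GREATEST k. R k)"
  have R0: "R 0" using D by (simp add: R_def)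
  have Rk: "R k"
    unfolding k_def by (rule GreatestI_nat[where k = 0 and b = "length D"]) (use R0 in \<open>auto simp: R_def\<close>)
  have Rmax: "R j \<Longrightarrow> j \<le> k" for j
    unfolding k_def by (rule Greatest_le_nat[of R j "length D"]) (auto simp: R_def)
  define A where "A = take k D"
  have kl: "k < length D" and A0: "count_list A True = count_list A False"
    using Rk by (auto simp: R_def A_def)
  obtain c S where DS: "D = A @ c # S"
    unfolding A_def using kl id_take_nth_drop by blast
  have "count_list (A @ [c]) False \<le> count_list (A @ [c]) True"
    by (rule dyck_prefixD[of _ S]) (use D DS in simp)
  then have c: "c" using A0 by (cases c) auto
  have tot: "count_list D True = count_list D False" using D by (simp add: dyck_def)
  have "S \<noteq> []" using tot DS c A0 by auto
  then obtain B e where S: "S = B @ [e]" by (metis rev_exhaust)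
  have "count_list (A @ c # B) False \<le> count_list (A @ c # B) True"
    by (rule dyck_prefixD[of _ "[e]"]) (use D DS S in simp)
  then have e: "\<not> e" using tot DS S A0 c by (cases e) auto
  have "dyck A" unfolding dyck_def
  proof (intro conjI A0 allI impI)
    fix P assume "prefix P A"
    then show "count_list P False \<le> count_list P True"
      using D DS by (auto simp: dyck_def)
  qed
  moreover have "dyck B" unfolding dyck_def
  proof (intro conjI allI impI)
    show "count_list B True = count_list B False" using tot DS S A0 c e by simp
    fix P assume "prefix P B"
    then obtain Q where Q: "B = P @ Q" by (auto simp: prefix_def)
    let ?P = "A @ True # P"
    have DP: "D = ?P @ Q @ [False]" using DS S Q c e by simp
    then have le: "count_list ?P False \<le> count_list ?P True" using D dyck_prefixD by metis
    have "\<not> R (length ?P)"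
      using Rmax[of "length ?P"] kl by (auto simp: A_def)
    then have "count_list ?P True \<noteq> count_list ?P False"
      unfolding R_def DP by simp
    then show "count_list P False \<le> count_list P True" using le A0 by simp
  qed
  ultimately show ?thesis using DS S c e by auto
qed

lemma dyck_split_eq:
  assumes "dyck D\<^sub>1" "dyck D\<^sub>2"
  shows "dyck_split (D\<^sub>1 @ [True] @ D\<^sub>2 @ [False]) = (D\<^sub>1, D\<^sub>2)"
  unfolding dyck_split_def
  by (rule the_equality) (use assms dyck_split_unique in \<open>auto simp del: append_Cons append_Nil\<close>)

function dyck_tree :: "path \<Rightarrow> unit tree" where
  "dyck_tree D =
     (if dyck D \<and> D \<noteq> []
      then Node (dyck_tree (fst (dyck_split D))) () (dyck_tree (snd (dyck_split D)))
      else Leaf)"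
  by pat_completeness auto
termination
proof (relation "measure length"; (elim conjE)?)
  fix D assume "dyck D" "D \<noteq> []"
  then obtain D\<^sub>1 D\<^sub>2 where "dyck D\<^sub>1" "dyck D\<^sub>2" "D = D\<^sub>1 @ [True] @ D\<^sub>2 @ [False]"
    using dyck_split_exists by blast
  then show "(fst (dyck_split D), D) \<in> measure length" "(snd (dyck_split D), D) \<in> measure length"
    using dyck_split_eq[of D\<^sub>1 D\<^sub>2] by simp_all
qed simp

declare dyck_tree.simps [simp del]

lemma dyck_tree_Nil: "dyck_tree [] = Leaf"
  by (simp add: dyck_tree.simps)

lemma dyck_join:
  assumes "dyck A" "dyck B"
  shows "dyck (A @ [True] @ B @ [False])"
  using assms by (fastforce simp: dyck_def prefix_append prefix_Cons)

lemma dyck_tree_join: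
  assumes "dyck D\<^sub>1" "dyck D\<^sub>2"
  shows "dyck_tree (D\<^sub>1 @ [True] @ D\<^sub>2 @ [False]) = Node (dyck_tree D\<^sub>1) () (dyck_tree D\<^sub>2)"
  using dyck_join[OF assms] dyck_split_eq[OF assms] by (subst dyck_tree.simps) simp


section \<open>The Tamari order\<close>

inductive right_rotation :: "unit tree \<Rightarrow> unit tree \<Rightarrow> bool" where
  root: "right_rotation (Node (Node A x B) y C) (Node A x (Node B y C))"
| left: "right_rotation L L' \<Longrightarrow> right_rotation (Node L x R) (Node L' x R)"
| right: "right_rotation R R' \<Longrightarrow> right_rotation (Node L x R) (Node L x R')"

definition tamari_le :: "path \<Rightarrow> path \<Rightarrow> bool" where
  "tamari_le D\<^sub>1 D\<^sub>2 \<longleftrightarrow> right_rotation\<^sup>*\<^sup>* (dyck_tree D\<^sub>1) (dyck_tree D\<^sub>2)"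

definition tamari_less :: "path \<Rightarrow> path \<Rightarrow> bool" where
  "tamari_less D\<^sub>1 D\<^sub>2 \<longleftrightarrow> tamari_le D\<^sub>1 D\<^sub>2 \<and> D\<^sub>1 \<noteq> D\<^sub>2"

definition tamari_intervals :: "nat \<Rightarrow> (path \<times> path) set" where
  "tamari_intervals n =
     {(D\<^sub>1, D\<^sub>2). D\<^sub>1 \<in> dyck_paths n \<and> D\<^sub>2 \<in> dyck_paths n \<and> tamari_le D\<^sub>1 D\<^sub>2}"

lemma finite_tamari_intervals: "finite (tamari_intervals n)"
  by (rule finite_subset[of _ "dyck_paths n \<times> dyck_paths n"])
     (auto simp: tamari_intervals_def finite_dyck_paths)

definition tamari_chains :: "path \<Rightarrow> path \<Rightarrow> path list set" where
  "tamari_chains D\<^sub>1 D\<^sub>2 =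
     {Ps. Ps \<noteq> [] \<and> hd Ps = D\<^sub>1 \<and> last Ps = D\<^sub>2 \<and>
          set Ps \<subseteq> dyck_paths (path_size D\<^sub>1) \<and> successively tamari_less Ps}"

text \<open>The maximum in \<open>tamari_dist\<close> below is over a finite nonempty set: the sum over all
  nodes of the sizes of their right subtrees increases strictly along chains.\<close>

fun right_weight :: "'a tree \<Rightarrow> nat" where
  "right_weight Leaf = 0"
| "right_weight (Node L _ R) = right_weight L + right_weight R + size R"

lemma size_right_rotation: "right_rotation S T \<Longrightarrow> size S = size T"
  by (induction rule: right_rotation.induct) auto

lemma right_weight_right_rotation: "right_rotation S T \<Longrightarrow> right_weight S < right_weight T"
  by (induction rule: right_rotation.induct) (auto dest: size_right_rotation)

lemma right_weight_rotations:
  "right_rotation\<^sup>*\<^sup>* S T \<Longrightarrow> S = T \<or> right_weight S < right_weight T"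
  by (induction rule: rtranclp_induct) (auto dest: right_weight_right_rotation)

lemma dyck_tree_inj:
  "dyck C \<Longrightarrow> dyck D \<Longrightarrow> dyck_tree C = dyck_tree D \<Longrightarrow> C = D"
proof (induction C arbitrary: D rule: length_induct)
  case (1 C)
  show ?case
  proof (cases "C = [] \<or> D = []")
    case True
    then show ?thesis
      using 1 dyck_tree.simps[of C] dyck_tree.simps[of D] by (auto split: if_splits)
  next
    case False
    obtain C1 C2 where C: "dyck C1" "dyck C2" "C = C1 @ [True] @ C2 @ [False]"
      using dyck_split_exists False 1 by blast
    obtain D1 D2 where D: "dyck D1" "dyck D2" "D = D1 @ [True] @ D2 @ [False]"
      using dyck_split_exists False 1 by blast
    have "dyck_tree C1 = dyck_tree D1" "dyck_tree C2 = dyck_tree D2"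
      using "1.prems"(3) dyck_tree_join[OF C(1,2)] dyck_tree_join[OF D(1,2)] C(3) D(3) by auto
    then have "C1 = D1" "C2 = D2" using "1.IH" C D by auto
    then show ?thesis using C D by simp
  qed
qed

lemma tamari_less_right_weight:
  assumes "dyck C" "dyck D" "tamari_less C D"
  shows "right_weight (dyck_tree C) < right_weight (dyck_tree D)"
  using assms right_weight_rotations dyck_tree_inj
  unfolding tamari_less_def tamari_le_def by blast

lemma length_tamari_chain:
  "Ps \<noteq> [] \<Longrightarrow> set Ps \<subseteq> Collect dyck \<Longrightarrow> successively tamari_less Ps \<Longrightarrow>
     length Ps \<le> Suc (right_weight (dyck_tree (last Ps)) - right_weight (dyck_tree (hd Ps))) \<and>
     right_weight (dyck_tree (hd Ps)) \<le> right_weight (dyck_tree (last Ps))"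
proof (induction Ps rule: induct_list012)
  case (3 C D Ps)
  then show ?case using tamari_less_right_weight[of C D] by (auto split: if_splits)
qed auto

lemma finite_tamari_chain_lengths:
  "finite ((\<lambda>Ps. length Ps - 1) ` tamari_chains D\<^sub>1 D\<^sub>2)"
proof (rule finite_subset)
  show "(\<lambda>Ps. length Ps - 1) ` tamari_chains D\<^sub>1 D\<^sub>2 \<subseteq> {..right_weight (dyck_tree D\<^sub>2)}"
    using length_tamari_chain by (fastforce simp: tamari_chains_def dyck_paths_def)
qed simp

lemma tamari_chains_nonempty:
  assumes "(D\<^sub>1, D\<^sub>2) \<in> tamari_intervals n"
  shows "tamari_chains D\<^sub>1 D\<^sub>2 \<noteq> {}"
proof -
  have "(if D\<^sub>1 = D\<^sub>2 then [D\<^sub>1] else [D\<^sub>1, D\<^sub>2]) \<in> tamari_chains D\<^sub>1 D\<^sub>2"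
    using assms by (auto simp: tamari_chains_def tamari_intervals_def tamari_less_def dyck_paths_def)
  then show ?thesis by blast
qed

definition tamari_dist :: "path \<times> path \<Rightarrow> nat" where
  "tamari_dist = (\<lambda>(D\<^sub>1, D\<^sub>2). Max ((\<lambda>Ps. length Ps - 1) ` tamari_chains D\<^sub>1 D\<^sub>2))"


section \<open>Statistics\<close>

definition contacts :: "path \<Rightarrow> nat" where
  "contacts D =
     card {k. k < length D \<and> count_list (take k D) True = count_list (take k D) False}"

definition rises :: "path \<Rightarrow> nat" where
  "rises D = length (takeWhile (\<lambda>s. s) D)"

definition step_positions :: "bool \<Rightarrow> path \<Rightarrow> nat list" where
  "step_positions s D = filter (\<lambda>k. D ! k = s) [0..<length D]"

definition after_step :: "bool \<Rightarrow> nat \<Rightarrow> path \<Rightarrow> path" where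
  "after_step s i D = drop (Suc (step_positions s D ! (i - 1))) D"

definition max_dyck_prefix :: "path \<Rightarrow> path" where
  "max_dyck_prefix P = take (Max {m. m \<le> length P \<and> dyck (take m P)}) P"

text \<open>In the next two definitions the index \<open>i\<close> counts steps from 1.\<close>

definition contacts_at :: "nat \<Rightarrow> path \<Rightarrow> nat" where
  "contacts_at i D = contacts (max_dyck_prefix (after_step True i D))"

definition rises_at :: "nat \<Rightarrow> path \<Rightarrow> nat" where
  "rises_at i D = rises (after_step False i D)"

definition contact_mon :: "path \<Rightarrow> (nat \<Rightarrow> 'a) \<Rightarrow> 'a::comm_monoid_mult" where
  "contact_mon D X = X (contacts D) * (\<Prod>i = 1..path_size D - 1. X (contacts_at i D))"

definition rise_mon :: "path \<Rightarrow> (nat \<Rightarrow> 'a) \<Rightarrow> 'a::comm_monoid_mult" where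
  "rise_mon D Y = Y (rises D) * (\<Prod>i = 1..path_size D - 1. Y (rises_at i D))"


section \<open>The generating function\<close>

text \<open>The variable \<open>t\<close> is the variable of the formal power series, so the terms
  with \<open>t ^ n\<close> are collected in the \<open>n\<close>-th coefficient.\<close>

definition Phi :: "'a \<Rightarrow> 'a \<Rightarrow> (nat \<Rightarrow> 'a) \<Rightarrow> (nat \<Rightarrow> 'a) \<Rightarrow> 'a \<Rightarrow> 'a::comm_ring_1 fps" where
  "Phi x y X Y q = Abs_fps (\<lambda>n. \<Sum>(D\<^sub>1, D\<^sub>2)\<in>tamari_intervals n.
     x ^ contacts D\<^sub>1 * y ^ rises D\<^sub>2 * contact_mon D\<^sub>1 X * rise_mon D\<^sub>2 Y * q ^ tamari_dist (D\<^sub>1, D\<^sub>2))"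

datatype indet = Ind_x | Ind_y | Ind_X nat | Ind_Y nat | Ind_q

text \<open>Integer polynomials in these indeterminates: finitely supported maps from
  monomials (finitely supported exponent vectors) to coefficients.\<close>

type_synonym pol = "(indet \<Rightarrow>\<^sub>0 nat) \<Rightarrow>\<^sub>0 int"

definition Var :: "indet \<Rightarrow> pol" where
  "Var v = Poly_Mapping.single (Poly_Mapping.single v 1) 1"

end

theory Submission
  imports Defs "HOL-Library.Multiset"
begin

text \<open>
  Mirroring binary trees reverses the Tamari order and keeps the length of chains, so it exchanges
  the contacts of the lower bound with the contacts of the mirrored upper bound. It remains to
  replace the latter by the rises. In Dyck path terms the elements below \<open>1 Q 0\<close> are
  the paths \<open>1 A 0 B\<close> with \<open>A B \<le> Q\<close>, and the order is compatible with factoring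
  the upper bound into prime paths. Hence an interval amounts to a plane forest (its upper
  bound) with a label at each vertex (the number of contacts of \<open>B\<close>). The labels determine the
  contacts of the lower bound and sum up to the distance, regardless of the order of siblings.
  Reversing all lists of siblings turns the paths of first children, whose lengths are the
  rises of the upper bound, into paths of last children, whose lengths are the contacts of its
  mirror image.
\<close>

section \<open>Concatenation of binary trees\<close>

text \<open>Concatenation of Dyck paths, see \<open>tree_path_cat\<close>. The root is the last
  prime factor, so \<open>S\<close> is grafted at the leftmost leaf.\<close>

fun cat :: "'a tree \<Rightarrow> 'a tree \<Rightarrow> 'a tree" where
  "cat S Leaf = S"
| "cat S (Node L x R) = Node (cat S L) x R"

text \<open>Each node on the left spine is a prime factor, so for the tree of a path this counts
  contacts. On flow trees it will measure paths of first children.\<close>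

fun lspine :: "'a tree \<Rightarrow> nat" where
  "lspine Leaf = 0"
| "lspine (Node L x R) = Suc (lspine L)"

text \<open>A right subtree is the part between an up-step and its matching down-step; these are the
  values of \<open>contacts_at\<close>, including the 0 at the last up-step.\<close>

fun lspines :: "'a tree \<Rightarrow> nat multiset" where
  "lspines Leaf = {#}"
| "lspines (Node L x R) = add_mset (lspine R) (lspines L + lspines R)"

lemma cat_Leaf [simp]: "cat Leaf T = T"
  by (induction T) auto

lemma cat_assoc: "cat (cat S T) U = cat S (cat T U)"
  by (induction U) auto

lemma size_cat [simp]: "size (cat S T) = size S + size T"
  by (induction T) auto

lemma lspine_cat [simp]: "lspine (cat S T) = lspine S + lspine T"
  by (induction T) auto

lemma lspines_cat [simp]: "lspines (cat S T) = lspines S + lspines T"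
  by (induction T) auto

lemma cat_eq_Leaf [simp]:
  "cat S T = Leaf \<longleftrightarrow> S = Leaf \<and> T = Leaf"
  "Leaf = cat S T \<longleftrightarrow> S = Leaf \<and> T = Leaf"
  by (cases T; auto)+

lemma cat_inject_size: "cat S T = cat S' T' \<Longrightarrow> size S = size S' \<Longrightarrow> S = S' \<and> T = T'"
proof (induction T arbitrary: T')
  case Leaf
  then have "size S = size S' + size T'" by (metis cat.simps(1) size_cat)
  then have "T' = Leaf" using Leaf by (cases T') auto
  then show ?case using Leaf by simp
next
  case (Node L x R)
  then have "size S + size (Node L x R) = size S' + size T'" by (metis size_cat)
  then obtain L' x' R' where "T' = Node L' x' R'" using Node by (cases T') auto
  then show ?case using Node by auto
qed

lemma cat_prime_inject [simp]:
  "cat (Node Leaf x A) B = cat (Node Leaf x' A') B' \<longleftrightarrow> x = x' \<and> A = A' \<and> B = B'"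
proof (induction B arbitrary: B')
  case Leaf
  show ?case by (cases B') auto
next
  case (Node L y R)
  show ?case using Node by (cases B') auto
qed

lemma prime_cat_exhaust:
  assumes "T \<noteq> Leaf"
  obtains x A B where "T = cat (Node Leaf x A) B"
  using assms
proof (induction T arbitrary: thesis)
  case (Node L x R)
  show ?case
  proof (cases "L = Leaf")
    case True
    then show ?thesis using Node.prems(1)[of x R Leaf] by simp
  next
    case False
    then obtain y A B where "L = cat (Node Leaf y A) B" using Node.IH(1) by blast
    then show ?thesis using Node.prems(1)[of y A "Node B x R"] by simp
  qed
qed simp


section \<open>Longest chains in the Tamari order\<close>

text \<open>\<open>longest n P Q\<close> means that \<open>P\<close> lies below \<open>Q\<close> and that the longest chain
  from \<open>P\<close> to \<open>Q\<close> has length \<open>n\<close>. In terms of Dyck paths the second rule says: the elements below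
  \<open>Q\<^sub>2 1 Q\<^sub>1 0\<close> are the paths \<open>P\<^sub>2 1 A 0 B\<close> with \<open>P\<^sub>2 \<le> Q\<^sub>2\<close> and \<open>A B \<le> Q\<^sub>1\<close>.\<close>

inductive longest :: "nat \<Rightarrow> unit tree \<Rightarrow> unit tree \<Rightarrow> bool" where
  Leaf: "longest 0 Leaf Leaf"
| Node: "longest m P\<^sub>2 Q\<^sub>2 \<Longrightarrow> longest k (cat A B) Q\<^sub>1 \<Longrightarrow>
    longest (m + k + lspine B) (cat P\<^sub>2 (cat (Node Leaf () A) B)) (Node Q\<^sub>2 () Q\<^sub>1)"

inductive_cases longest_LeafE: "longest n P Leaf"
inductive_cases longest_NodeE: "longest n P (Node Q\<^sub>2 x Q\<^sub>1)"

lemma longest_size: "longest n P Q \<Longrightarrow> size P = size Q"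
  by (induction rule: longest.induct) auto

lemma longest_refl: "longest 0 Q Q"
proof (induction Q)
  case (Node L x R)
  then show ?case using longest.Node[of 0 L L 0 R Leaf R] by simp
qed (rule longest.Leaf)

text \<open>The decomposition in rule \<open>Node\<close> is forced: the size of
  \<open>Q\<^sub>2\<close> fixes the cut of the lower bound, and the prime factor that follows is
  unique.\<close>

lemma longest_unique: "longest n P Q \<Longrightarrow> longest n' P Q \<Longrightarrow> n = n'"
proof (induction arbitrary: n' rule: longest.induct)
  case Leaf
  then show ?case by (auto elim: longest_LeafE)
next
  case (Node m P\<^sub>2 Q\<^sub>2 k A B Q\<^sub>1)
  from Node.prems obtain m' P' k' A' B' where *: "n' = m' + k' + lspine B'"
    "cat P\<^sub>2 (cat (Node Leaf () A) B) = cat P' (cat (Node Leaf () A') B')"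
    "longest m' P' Q\<^sub>2" "longest k' (cat A' B') Q\<^sub>1"
    by (auto elim: longest_NodeE)
  then have "P\<^sub>2 = P' \<and> cat (Node Leaf () A) B = cat (Node Leaf () A') B'"
    using cat_inject_size longest_size Node.hyps by metis
  then show ?case using * Node.IH by auto
qed

lemma longest_prime:
  "longest k (cat A B) Q \<Longrightarrow> longest (k + lspine B) (cat (Node Leaf () A) B) (Node Leaf () Q)"
  using longest.Node[OF longest.Leaf] by simp

lemma longest_cat: "longest m P' Q' \<Longrightarrow> longest n P Q \<Longrightarrow> longest (n + m) (cat P P') (cat Q Q')"
proof (induction rule: longest.induct)
  case (Node m P\<^sub>2 Q\<^sub>2 k A B Q\<^sub>1)
  then show ?case using longest.Node[of "n + m" "cat P P\<^sub>2"]
    by (simp add: cat_assoc add.assoc)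
qed simp

lemma longest_catE:
  assumes "longest n P (cat Q Q')"
  obtains n\<^sub>1 n\<^sub>2 P\<^sub>1 P\<^sub>2 where "P = cat P\<^sub>1 P\<^sub>2" "longest n\<^sub>1 P\<^sub>1 Q" "longest n\<^sub>2 P\<^sub>2 Q'"
  using assms
proof (induction Q' arbitrary: n P thesis)
  case Leaf
  then show ?case using longest.Leaf by (metis cat.simps(1))
next
  case (Node L x R)
  from Node.prems(2) obtain m S k A B where *: "P = cat S (cat (Node Leaf () A) B)"
    "longest m S (cat Q L)" "longest k (cat A B) R"
    by (auto elim: longest_NodeE)
  from Node.IH(1)[OF _ *(2)] obtain n\<^sub>1 n\<^sub>2 P\<^sub>1 P\<^sub>2 where
    "S = cat P\<^sub>1 P\<^sub>2" "longest n\<^sub>1 P\<^sub>1 Q" "longest n\<^sub>2 P\<^sub>2 L" by blast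
  then show ?case
    using Node.prems(1)[of P\<^sub>1 "cat P\<^sub>2 (cat (Node Leaf () A) B)"] * longest.Node[OF _ *(3), of n\<^sub>2 P\<^sub>2 L]
    by (auto simp: cat_assoc)
qed

text \<open>Starting from \<open>longest_refl\<close>, this makes the index an upper bound for the
  number of rotations from \<open>P\<close> to \<open>Q\<close>.\<close>

lemma longest_step:
  "right_rotation Q Q' \<Longrightarrow> longest n P Q \<Longrightarrow> \<exists>n'>n. longest n' P Q'"
proof (induction arbitrary: n P rule: right_rotation.induct)
  case (root A x B y C)
  from root obtain m S k A1 B1 where 1: "n = m + k + lspine B1"
    "P = cat S (cat (Node Leaf () A1) B1)" "longest m S (Node A () B)" "longest k (cat A1 B1) C"
    by (auto elim: longest_NodeE)
  from 1(3) obtain m' S' k' A2 B2 where 2: "m = m' + k' + lspine B2"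
    "S = cat S' (cat (Node Leaf () A2) B2)" "longest m' S' A" "longest k' (cat A2 B2) B"
    by (auto elim: longest_NodeE)
  have "longest (k' + k + lspine B1) (cat A2 (cat B2 (cat (Node Leaf () A1) B1))) (Node B () C)"
    using longest.Node[OF 2(4) 1(4)] by (simp add: cat_assoc)
  \<comment> \<open>The factor of \<open>A2\<close> is now followed by \<open>B2\<close>, the factor
    of \<open>A1\<close> and \<open>B1\<close>, so its contribution grows from
    \<open>lspine B2\<close> by \<open>1 + lspine B1\<close>.\<close>
  from longest.Node[OF 2(3) this]
  have "longest (m' + (k' + k + lspine B1) + (lspine B2 + Suc (lspine B1))) P
    (Node A x (Node B y C))"
    by (simp add: 1(2) 2(2) cat_assoc)
  moreover have "n < m' + (k' + k + lspine B1) + (lspine B2 + Suc (lspine B1))"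
    using 1(1) 2(1) by simp
  ultimately show ?case by blast
next
  case (left L L' x R)
  from left.prems obtain m S k A B where *: "n = m + k + lspine B"
    "P = cat S (cat (Node Leaf () A) B)" "longest m S L" "longest k (cat A B) R"
    by (auto elim: longest_NodeE)
  obtain m' where "m' > m" "longest m' S L'" using left.IH *(3) by blast
  then have "longest (m' + k + lspine B) P (Node L' x R)" "n < m' + k + lspine B"
    using longest.Node[OF _ *(4)] *(1,2) by auto
  then show ?case by blast
next
  case (right R R' L x)
  from right.prems obtain m S k A B where *: "n = m + k + lspine B"
    "P = cat S (cat (Node Leaf () A) B)" "longest m S L" "longest k (cat A B) R"
    by (auto elim: longest_NodeE)
  obtain k' where "k' > k" "longest k' (cat A B) R'" using right.IH *(4) by blast
  then have "longest (m + k' + lspine B) P (Node L x R')" "n < m + k' + lspine B"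
    using longest.Node[OF *(3)] *(1,2) by auto
  then show ?case by blast
qed

lemma longest_steps:
  "(right_rotation ^^ k) P Q \<Longrightarrow> \<exists>n\<ge>k. longest n P Q"
proof (induction k arbitrary: Q)
  case 0
  then show ?case using longest_refl by auto
next
  case (Suc k)
  then obtain R where R: "(right_rotation ^^ k) P R" "right_rotation R Q" by auto
  then obtain n where "n \<ge> k" "longest n P R" using Suc.IH by blast
  then show ?case using R(2) longest_step by (metis Suc_leI le_less_trans)
qed

lemma rotations_left:
  "(right_rotation ^^ k) L L' \<Longrightarrow> (right_rotation ^^ k) (Node L x R) (Node L' x R)"
  by (induction k arbitrary: L') (auto intro: right_rotation.left)

lemma rotations_right:
  "(right_rotation ^^ k) R R' \<Longrightarrow> (right_rotation ^^ k) (Node L x R) (Node L x R')"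
  by (induction k arbitrary: R') (auto intro: right_rotation.right)

text \<open>Each rotation moves one prime factor of \<open>B\<close> below the factor \<open>1 A 0\<close> in front of it.\<close>

lemma rotations_absorb:
  "(right_rotation ^^ lspine B) (cat P (cat (Node Leaf () A) B)) (Node P () (cat A B))"
proof (induction B)
  case (Node L x R)
  have "(right_rotation ^^ lspine L)
     (Node (cat P (cat (Node Leaf () A) L)) x R) (Node (Node P () (cat A L)) x R)"
    using rotations_left[OF Node.IH(1)] .
  moreover have "right_rotation (Node (Node P () (cat A L)) x R) (Node P () (Node (cat A L) x R))"
    by (rule right_rotation.root)
  ultimately show ?case by auto
qed auto

text \<open>The index is attained: first absorb \<open>B\<close>, then rotate within the right and
  the left subtree.\<close>

lemma longest_rotations: "longest n P Q \<Longrightarrow> (right_rotation ^^ n) P Q"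
proof (induction rule: longest.induct)
  case (Node m P\<^sub>2 Q\<^sub>2 k A B Q\<^sub>1)
  have "(right_rotation ^^ (lspine B + k + m)) (cat P\<^sub>2 (cat (Node Leaf () A) B)) (Node Q\<^sub>2 () Q\<^sub>1)"
    unfolding relpowp_add
    using rotations_absorb rotations_right[OF Node.IH(2)] rotations_left[OF Node.IH(1)] by blast
  then show ?case by (simp add: add.commute add.left_commute)
qed auto

text \<open>The inductive rules treat left and right differently; this description by rotations
  alone makes the mirror symmetry visible.\<close>

lemma longest_iff:
  "longest n P Q \<longleftrightarrow>
     (right_rotation ^^ n) P Q \<and> (\<forall>k. (right_rotation ^^ k) P Q \<longrightarrow> k \<le> n)"
proof
  assume n: "longest n P Q"
  have "k \<le> n" if "(right_rotation ^^ k) P Q" for k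
    using longest_steps[OF that] longest_unique[OF n] by blast
  then show "(right_rotation ^^ n) P Q \<and> (\<forall>k. (right_rotation ^^ k) P Q \<longrightarrow> k \<le> n)"
    using longest_rotations[OF n] by blast
next
  assume n: "(right_rotation ^^ n) P Q \<and> (\<forall>k. (right_rotation ^^ k) P Q \<longrightarrow> k \<le> n)"
  then obtain m where m: "n \<le> m" "longest m P Q" using longest_steps by blast
  then have "m \<le> n" using n longest_rotations by blast
  then show "longest n P Q" using m by simp
qed

lemma rotations_iff_longest: "right_rotation\<^sup>*\<^sup>* P Q \<longleftrightarrow> (\<exists>n. longest n P Q)"
  using longest_steps longest_rotations rtranclp_power[of right_rotation P Q] by blast

section \<open>Mirror symmetry of the order and of the distance\<close>

lemma right_rotation_mirror:
  "right_rotation S T \<Longrightarrow> right_rotation (mirror T) (mirror S)"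
  by (induction rule: right_rotation.induct) (auto intro: right_rotation.intros)

lemma rotations_mirror:
  "(right_rotation ^^ k) S T \<Longrightarrow> (right_rotation ^^ k) (mirror T) (mirror S)"
proof (induction k arbitrary: T)
  case (Suc k)
  then obtain R where "(right_rotation ^^ k) S R" "right_rotation R T" by auto
  then show ?case using Suc.IH right_rotation_mirror relpowp_Suc_I2 by fast
qed simp

lemma longest_mirror: "longest n (mirror Q) (mirror P) \<longleftrightarrow> longest n P Q"
proof -
  have "(right_rotation ^^ k) (mirror Q) (mirror P) \<longleftrightarrow> (right_rotation ^^ k) P Q" for k
    using rotations_mirror[of k P Q] rotations_mirror[of k "mirror Q" "mirror P"] by auto
  then show ?thesis by (simp add: longest_iff)
qed

definition rotation_dist :: "unit tree \<Rightarrow> unit tree \<Rightarrow> nat" where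
  "rotation_dist P Q = (THE n. longest n P Q)"

lemma rotation_dist_eq: "longest n P Q \<Longrightarrow> rotation_dist P Q = n"
  unfolding rotation_dist_def by (rule the_equality, assumption, rule longest_unique)

lemma rotation_dist_mirror: "rotation_dist (mirror Q) (mirror P) = rotation_dist P Q"
  by (simp add: rotation_dist_def longest_mirror)

definition tree_intervals :: "nat \<Rightarrow> (unit tree \<times> unit tree) set" where
  "tree_intervals n = {(P, Q). size P = n \<and> right_rotation\<^sup>*\<^sup>* P Q}"

lemma mem_tree_intervals: "(P, Q) \<in> tree_intervals n \<longleftrightarrow> size P = n \<and> (\<exists>k. longest k P Q)"
  by (simp add: tree_intervals_def rotations_iff_longest)


section \<open>Flow trees\<close>

text \<open>A node \<open>Node T\<^sub>1 j T\<^sub>2\<close> receives \<open>out T\<^sub>1\<close> units of flow from its left child, absorbs all but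
  \<open>j\<close> of them, adds one unit and lets the flow from \<open>T\<^sub>2\<close> pass. These trees are the grafting trees
  of Tamari intervals; the absorbed amounts become the contacts of the lower bound.\<close>

fun out :: "nat tree \<Rightarrow> nat" where
  "out Leaf = 0"
| "out (Node T\<^sub>1 j T\<^sub>2) = Suc (j + out T\<^sub>2)"

fun absorbed :: "nat tree \<Rightarrow> nat multiset" where
  "absorbed Leaf = {#}"
| "absorbed (Node T\<^sub>1 j T\<^sub>2) = add_mset (out T\<^sub>1 - j) (absorbed T\<^sub>1 + absorbed T\<^sub>2)"

text \<open>\<open>out T\<^sub>1\<close> is the number of prime factors of the lower bound encoded
  by \<open>T\<^sub>1\<close>; the last \<open>j\<close> of them stay outside in
  \<open>nest\<close>.\<close>

fun flow :: "nat tree \<Rightarrow> bool" where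
  "flow Leaf \<longleftrightarrow> True"
| "flow (Node T\<^sub>1 j T\<^sub>2) \<longleftrightarrow> flow T\<^sub>1 \<and> flow T\<^sub>2 \<and> j \<le> out T\<^sub>1"

definition flow_trees :: "nat \<Rightarrow> nat tree set" where
  "flow_trees n = {T. flow T \<and> size T = n}"

text \<open>\<open>nest j (A B) = 1 A 0 B\<close> where \<open>B\<close> consists of the last \<open>j\<close> prime factors.\<close>

fun nest :: "nat \<Rightarrow> unit tree \<Rightarrow> unit tree" where
  "nest 0 P = Node Leaf () P"
| "nest (Suc j) (Node L x R) = Node (nest j L) x R"
| "nest (Suc j) Leaf = Leaf"

lemma nest_cat [simp]: "nest (lspine B) (cat A B) = cat (Node Leaf () A) B"
  by (induction B) auto

lemma split_lspine:
  assumes "j \<le> lspine P"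
  obtains A B where "P = cat A B" "lspine B = j"
  using assms
proof (induction P arbitrary: j thesis)
  case (Node L x R)
  show ?case
  proof (cases j)
    case 0
    then show ?thesis using Node.prems(1)[of "Node L x R" Leaf] by simp
  next
    case (Suc i)
    then obtain A B where "L = cat A B" "lspine B = i" using Node.prems(2) Node.IH(1)[of i] by auto
    then show ?thesis using Node.prems(1)[of A "Node B x R"] Suc by simp
  qed
qed simp

text \<open>\<open>lspine P - j\<close> counts the enclosed factors. The bound on \<open>j\<close>
  excludes the default \<open>nest (Suc j) Leaf = Leaf\<close>.\<close>

lemma nest_simps:
  assumes "j \<le> lspine P"
  shows "lspine (nest j P) = Suc j" "size (nest j P) = Suc (size P)"
    "lspines (nest j P) = add_mset (lspine P - j) (lspines P)"
proof -
  obtain A B where "P = cat A B" "lspine B = j" using split_lspine[OF assms] by metis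
  then show "lspine (nest j P) = Suc j" "size (nest j P) = Suc (size P)"
    "lspines (nest j P) = add_mset (lspine P - j) (lspines P)"
    by auto
qed

lemma nest_inject:
  assumes "nest j P = nest j' P'" "j \<le> lspine P" "j' \<le> lspine P'"
  shows "j = j' \<and> P = P'"
proof -
  obtain A B where "P = cat A B" "lspine B = j" using split_lspine assms by metis
  moreover obtain A' B' where "P' = cat A' B'" "lspine B' = j'" using split_lspine assms by metis
  ultimately show ?thesis using assms by auto
qed

lemma longest_nest:
  assumes "longest k P Q" "j \<le> lspine P"
  shows "longest (k + j) (nest j P) (Node Leaf () Q)"
proof -
  obtain A B where "P = cat A B" "lspine B = j" using split_lspine assms by metis
  then show ?thesis using longest_prime assms by auto
qed

lemma longest_nestE:
  assumes "longest n P (Node Leaf () Q)"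
  obtains j k P' where "P = nest j P'" "j \<le> lspine P'" "longest k P' Q"
proof -
  from assms obtain m S k A B where *: "P = cat S (cat (Node Leaf () A) B)"
    "longest m S Leaf" "longest k (cat A B) Q"
    by (auto elim: longest_NodeE)
  then have "S = Leaf" by (auto elim: longest_LeafE)
  then show ?thesis using * that[of "lspine B" "cat A B"] by simp
qed

text \<open>The distance of the encoded interval, by \<open>longest_first\<close> and
  \<open>longest_last\<close> alike.\<close>

fun sum_labels :: "nat tree \<Rightarrow> nat" where
  "sum_labels Leaf = 0"
| "sum_labels (Node T\<^sub>1 j T\<^sub>2) = sum_labels T\<^sub>1 + j + sum_labels T\<^sub>2"


text \<open>A flow tree encodes an interval in two ways: by the first prime factor of the upper bound,
  or by the last one.\<close>

fun low_first :: "nat tree \<Rightarrow> unit tree" where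
  "low_first Leaf = Leaf"
| "low_first (Node T\<^sub>1 j T\<^sub>2) = cat (nest j (low_first T\<^sub>1)) (low_first T\<^sub>2)"

fun up_first :: "nat tree \<Rightarrow> unit tree" where
  "up_first Leaf = Leaf"
| "up_first (Node T\<^sub>1 j T\<^sub>2) = cat (Node Leaf () (up_first T\<^sub>1)) (up_first T\<^sub>2)"

fun low_last :: "nat tree \<Rightarrow> unit tree" where
  "low_last Leaf = Leaf"
| "low_last (Node T\<^sub>1 j T\<^sub>2) = cat (low_last T\<^sub>2) (nest j (low_last T\<^sub>1))"

fun up_last :: "nat tree \<Rightarrow> unit tree" where
  "up_last Leaf = Leaf"
| "up_last (Node T\<^sub>1 j T\<^sub>2) = Node (up_last T\<^sub>2) () (up_last T\<^sub>1)"

text \<open>\<open>lspine\<close> and \<open>lspines\<close> are additive over \<open>cat\<close>,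
  hence blind to the order of siblings. So both encodings give lower bounds with the same contact
  statistics.\<close>

lemma lspine_low_first: "flow T \<Longrightarrow> lspine (low_first T) = out T"
  by (induction T) (auto simp: nest_simps)

lemma lspines_low_first: "flow T \<Longrightarrow> lspines (low_first T) = absorbed T"
  by (induction T) (auto simp: nest_simps lspine_low_first)

lemma lspine_low_last: "flow T \<Longrightarrow> lspine (low_last T) = out T"
  by (induction T) (auto simp: nest_simps)

lemma lspines_low_last: "flow T \<Longrightarrow> lspines (low_last T) = absorbed T"
  by (induction T) (auto simp: nest_simps lspine_low_last)

text \<open>\<open>mirror\<close> undoes the exchange of subtrees in \<open>up_last\<close>:
  \<open>mirror (up_last T)\<close> is \<open>T\<close> with its labels erased.\<close>

lemma lspine_up_last: "lspine (mirror (up_last T)) = lspine T"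
  by (induction T) auto

lemma lspines_up_last: "lspines (mirror (up_last T)) = lspines T"
  by (induction T) (auto simp: lspine_up_last)

lemma size_up_first [simp]: "size (up_first T) = size T"
  by (induction T) auto

lemma size_up_last [simp]: "size (up_last T) = size T"
  by (induction T) auto

lemma longest_first: "flow T \<Longrightarrow> longest (sum_labels T) (low_first T) (up_first T)"
proof (induction T)
  case (Node T\<^sub>1 j T\<^sub>2)
  then have "longest (sum_labels T\<^sub>1 + j) (nest j (low_first T\<^sub>1)) (Node Leaf () (up_first T\<^sub>1))"
    by (auto intro: longest_nest simp: lspine_low_first)
  from longest_cat[OF _ this] Node show ?case by simp
qed (simp add: longest.Leaf)

lemma longest_last: "flow T \<Longrightarrow> longest (sum_labels T) (low_last T) (up_last T)"
proof (induction T)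
  case (Node T\<^sub>1 j T\<^sub>2)
  then have "longest (sum_labels T\<^sub>1 + j) (nest j (low_last T\<^sub>1)) (Node Leaf () (up_last T\<^sub>1))"
    by (auto intro: longest_nest simp: lspine_low_last)
  from longest_cat[OF this] Node show ?case by (simp add: add.commute)
qed (simp add: longest.Leaf)

lemma size_low_first [simp]: "flow T \<Longrightarrow> size (low_first T) = size T"
  using longest_size[OF longest_first] by simp

lemma size_low_last [simp]: "flow T \<Longrightarrow> size (low_last T) = size T"
  using longest_size[OF longest_last] by simp

text \<open>The upper bound determines the shape of the flow tree, its sizes determine the cuts of
  the lower bound, and \<open>nest_inject\<close> recovers the labels.\<close>

lemma first_inject:
  "flow T \<Longrightarrow> flow T' \<Longrightarrow> low_first T = low_first T' \<Longrightarrow> up_first T = up_first T' \<Longrightarrow> T = T'"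
proof (induction T arbitrary: T')
  case Leaf
  then show ?case by (cases T') auto
next
  case (Node T\<^sub>1 j T\<^sub>2)
  then obtain T\<^sub>1' j' T\<^sub>2' where T': "T' = Node T\<^sub>1' j' T\<^sub>2'" by (cases T') auto
  have up: "up_first T\<^sub>1 = up_first T\<^sub>1'" "up_first T\<^sub>2 = up_first T\<^sub>2'"
    using Node.prems T' by auto
  have "size T\<^sub>1 = size T\<^sub>1'" using up by (metis size_up_first)
  then have "nest j (low_first T\<^sub>1) = nest j' (low_first T\<^sub>1') \<and> low_first T\<^sub>2 = low_first T\<^sub>2'"
    using Node.prems T' by (intro cat_inject_size) (auto simp: nest_simps lspine_low_first)
  then show ?case
    using Node T' up nest_inject[of j "low_first T\<^sub>1" j' "low_first T\<^sub>1'"]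
    by (auto simp: lspine_low_first)
qed

lemma last_inject:
  "flow T \<Longrightarrow> flow T' \<Longrightarrow> low_last T = low_last T' \<Longrightarrow> up_last T = up_last T' \<Longrightarrow> T = T'"
proof (induction T arbitrary: T')
  case Leaf
  then show ?case by (cases T') auto
next
  case (Node T\<^sub>1 j T\<^sub>2)
  then obtain T\<^sub>1' j' T\<^sub>2' where T': "T' = Node T\<^sub>1' j' T\<^sub>2'" by (cases T') auto
  have up: "up_last T\<^sub>1 = up_last T\<^sub>1'" "up_last T\<^sub>2 = up_last T\<^sub>2'"
    using Node.prems T' by auto
  have "size T\<^sub>2 = size T\<^sub>2'" using up by (metis size_up_last)
  then have "low_last T\<^sub>2 = low_last T\<^sub>2' \<and> nest j (low_last T\<^sub>1) = nest j' (low_last T\<^sub>1')"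
    using Node.prems T' by (intro cat_inject_size) auto
  then show ?case
    using Node T' up nest_inject[of j "low_last T\<^sub>1" j' "low_last T\<^sub>1'"]
    by (auto simp: lspine_low_last)
qed

lemma first_surj:
  "longest n P Q \<Longrightarrow> \<exists>T. flow T \<and> P = low_first T \<and> Q = up_first T"
\<comment> \<open>Splitting off the first prime factor does not yield subtrees of \<open>Q\<close>,
  hence the induction on size.\<close>
proof (induction "size Q" arbitrary: n P Q rule: less_induct)
  case less
  show ?case
  proof (cases "Q = Leaf")
    case True
    then show ?thesis using less.prems by (intro exI[of _ Leaf]) (auto elim: longest_LeafE)
  next
    case False
    then obtain Q\<^sub>1 Q\<^sub>2 where Q: "Q = cat (Node Leaf () Q\<^sub>1) Q\<^sub>2"
      by (metis (full_types) prime_cat_exhaust old.unit.exhaust)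
    from less.prems obtain m S k P\<^sub>2 where
      P: "P = cat S P\<^sub>2" "longest m S (Node Leaf () Q\<^sub>1)" "longest k P\<^sub>2 Q\<^sub>2"
      unfolding Q by (rule longest_catE)
    from P(2) obtain j l P\<^sub>1 where S: "S = nest j P\<^sub>1" "j \<le> lspine P\<^sub>1" "longest l P\<^sub>1 Q\<^sub>1"
      by (rule longest_nestE)
    obtain T\<^sub>1 where "flow T\<^sub>1" "P\<^sub>1 = low_first T\<^sub>1" "Q\<^sub>1 = up_first T\<^sub>1"
      using less.hyps[OF _ S(3)] Q by auto
    moreover obtain T\<^sub>2 where "flow T\<^sub>2" "P\<^sub>2 = low_first T\<^sub>2" "Q\<^sub>2 = up_first T\<^sub>2"
      using less.hyps[OF _ P(3)] Q by auto
    ultimately show ?thesis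
      using P Q S by (intro exI[of _ "Node T\<^sub>1 j T\<^sub>2"]) (auto simp: lspine_low_first)
  qed
qed

lemma last_surj:
  "longest n P Q \<Longrightarrow> \<exists>T. flow T \<and> P = low_last T \<and> Q = up_last T"
proof (induction Q arbitrary: n P)
  case Leaf
  then show ?case by (intro exI[of _ Leaf]) (auto elim: longest_LeafE)
next
  case (Node Q\<^sub>2 x Q\<^sub>1)
  from Node.prems have "longest n P (cat Q\<^sub>2 (Node Leaf () Q\<^sub>1))" by simp
  then obtain m S k P\<^sub>2 where
    P: "P = cat P\<^sub>2 S" "longest k P\<^sub>2 Q\<^sub>2" "longest m S (Node Leaf () Q\<^sub>1)"
    by (rule longest_catE)
  from P(3) obtain j l P\<^sub>1 where S: "S = nest j P\<^sub>1" "j \<le> lspine P\<^sub>1" "longest l P\<^sub>1 Q\<^sub>1"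
    by (rule longest_nestE)
  obtain T\<^sub>1 where "flow T\<^sub>1" "P\<^sub>1 = low_last T\<^sub>1" "Q\<^sub>1 = up_last T\<^sub>1"
    using Node.IH(2)[OF S(3)] by auto
  moreover obtain T\<^sub>2 where "flow T\<^sub>2" "P\<^sub>2 = low_last T\<^sub>2" "Q\<^sub>2 = up_last T\<^sub>2"
    using Node.IH(1)[OF P(2)] by auto
  ultimately show ?case
    using P S by (intro exI[of _ "Node T\<^sub>1 j T\<^sub>2"]) (auto simp: lspine_low_last)
qed

section \<open>Two bijections between flow trees and intervals\<close>

lemma bij_betw_first:
  "bij_betw (\<lambda>T. (low_first T, up_first T)) (flow_trees n) (tree_intervals n)"
  unfolding bij_betw_def
proof
  show "inj_on (\<lambda>T. (low_first T, up_first T)) (flow_trees n)"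
    by (auto simp: inj_on_def flow_trees_def intro: first_inject)
  show "(\<lambda>T. (low_first T, up_first T)) ` flow_trees n = tree_intervals n"
  proof (intro equalityI subsetI)
    fix I assume "I \<in> tree_intervals n"
    then obtain k where "longest k (fst I) (snd I)" "size (fst I) = n"
      by (cases I) (auto simp: mem_tree_intervals)
    from first_surj[OF this(1)] this(2) show "I \<in> (\<lambda>T. (low_first T, up_first T)) ` flow_trees n"
      by (cases I) (auto simp: flow_trees_def)
  qed (use longest_first in \<open>fastforce simp: flow_trees_def mem_tree_intervals\<close>)
qed

lemma bij_betw_last:
  "bij_betw (\<lambda>T. (low_last T, up_last T)) (flow_trees n) (tree_intervals n)"
  unfolding bij_betw_def
proof
  show "inj_on (\<lambda>T. (low_last T, up_last T)) (flow_trees n)"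
    by (auto simp: inj_on_def flow_trees_def intro: last_inject)
  show "(\<lambda>T. (low_last T, up_last T)) ` flow_trees n = tree_intervals n"
  proof (intro equalityI subsetI)
    fix I assume "I \<in> tree_intervals n"
    then obtain k where "longest k (fst I) (snd I)" "size (fst I) = n"
      by (cases I) (auto simp: mem_tree_intervals)
    from last_surj[OF this(1)] this(2) show "I \<in> (\<lambda>T. (low_last T, up_last T)) ` flow_trees n"
      by (cases I) (auto simp: flow_trees_def)
  qed (use longest_last in \<open>fastforce simp: flow_trees_def mem_tree_intervals\<close>)
qed

lemma bij_betw_mirror:
  "bij_betw (\<lambda>(P, Q). (mirror Q, mirror P)) (tree_intervals n) (tree_intervals n)"
  by (rule bij_betw_byWitness[where f' = "\<lambda>(P, Q). (mirror Q, mirror P)"])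
     (use longest_size in \<open>auto simp: mem_tree_intervals longest_mirror\<close>)


section \<open>Statistics of Dyck paths in terms of trees\<close>

fun tree_path :: "unit tree \<Rightarrow> path" where
  "tree_path Leaf = []"
| "tree_path (Node L x R) = tree_path L @ [True] @ tree_path R @ [False]"

lemma dyck_tree_path: "dyck (tree_path T)"
  by (induction T) (auto simp: dyck_def[of "[]"] intro: dyck_join simp del: append_Cons append_Nil)

lemma dyck_tree_tree_path [simp]: "dyck_tree (tree_path T) = T"
  by (induction T) (auto simp: dyck_tree_Nil dyck_tree_join dyck_tree_path simp del: append_Cons append_Nil)

lemma tree_path_dyck_tree: "dyck D \<Longrightarrow> tree_path (dyck_tree D) = D"
  by (rule dyck_tree_inj) (auto simp: dyck_tree_path)

lemma path_size_tree_path [simp]: "path_size (tree_path T) = size T"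
  by (induction T) (auto simp: path_size_def)

lemma tree_path_cat: "tree_path (cat S T) = tree_path S @ tree_path T"
  by (induction T) auto

lemma mem_dyck_paths: "D \<in> dyck_paths n \<longleftrightarrow> (\<exists>T. D = tree_path T \<and> size T = n)"
  unfolding dyck_paths_def using dyck_tree_path tree_path_dyck_tree path_size_tree_path
  by (metis (mono_tags, lifting) mem_Collect_eq)

lemma bij_betw_tree_path:
  "bij_betw (map_prod tree_path tree_path) (tree_intervals n) (tamari_intervals n)"
proof (rule bij_betw_byWitness[where f' = "map_prod dyck_tree dyck_tree"])
  show "map_prod tree_path tree_path ` tree_intervals n \<subseteq> tamari_intervals n"
    by (auto simp: tamari_intervals_def mem_dyck_paths tamari_le_def tree_intervals_def)
       (metis longest_size rotations_iff_longest)
qed (auto simp: tamari_intervals_def mem_dyck_paths tamari_le_def tree_intervals_def)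

section \<open>Chains of paths and sequences of rotations\<close>

lemma rotations_of_tamari_chain:
  "Ps \<noteq> [] \<Longrightarrow> set Ps \<subseteq> Collect dyck \<Longrightarrow> successively tamari_less Ps \<Longrightarrow>
     \<exists>k\<ge>length Ps - 1. (right_rotation ^^ k) (dyck_tree (hd Ps)) (dyck_tree (last Ps))"
proof (induction Ps rule: induct_list012)
  case (2 C)
  then show ?case by (auto intro: exI[of _ 0])
next
  case (3 C D Ps)
  then obtain k where k: "k \<ge> length Ps"
    "(right_rotation ^^ k) (dyck_tree D) (dyck_tree (last (D # Ps)))" by auto
  have "right_rotation\<^sup>*\<^sup>* (dyck_tree C) (dyck_tree D)" "dyck_tree C \<noteq> dyck_tree D"
    using 3 dyck_tree_inj[of C D] by (auto simp: tamari_less_def tamari_le_def)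
  \<comment> \<open>Steps of a chain are strict but need not be covers, so each one amounts to at
    least one rotation.\<close>
  then obtain m where m: "(right_rotation ^^ m) (dyck_tree C) (dyck_tree D)" "m > 0"
    by (metis rtranclp_imp_relpowp gr0I relpowp_0_E)
  have "(right_rotation ^^ (m + k)) (dyck_tree C) (dyck_tree (last (D # Ps)))"
    unfolding relpowp_add using m k by blast
  then show ?case using m k by (intro exI[of _ "m + k"]) auto
qed auto

lemma tamari_chain_of_rotations:
  "(right_rotation ^^ k) P Q \<Longrightarrow>
     \<exists>Ps\<in>tamari_chains (tree_path P) (tree_path Q). length Ps = Suc k"
proof (induction k arbitrary: Q)
  case 0
  then show ?case
    by (intro bexI[of _ "[tree_path P]"]) (auto simp: tamari_chains_def mem_dyck_paths)
next
  case (Suc k)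
  then obtain R where R: "(right_rotation ^^ k) P R" "right_rotation R Q" by auto
  then obtain Ps where Ps: "Ps \<in> tamari_chains (tree_path P) (tree_path R)" "length Ps = Suc k"
    using Suc.IH by blast
  have "R \<noteq> Q" using right_weight_right_rotation[OF R(2)] by auto
  then have "tamari_less (tree_path R) (tree_path Q)"
    using R(2) unfolding tamari_less_def tamari_le_def
    by (metis dyck_tree_tree_path r_into_rtranclp)
  moreover have "size Q = size P"
    using longest_steps[OF Suc.prems] longest_size by metis
  ultimately show ?case using Ps
    by (intro bexI[of _ "Ps @ [tree_path Q]"])
       (auto simp: tamari_chains_def mem_dyck_paths successively_append_iff)
qed

lemma tamari_dist_tree_path:
  assumes "(P, Q) \<in> tree_intervals n"
  shows "tamari_dist (tree_path P, tree_path Q) = rotation_dist P Q"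
proof -
  obtain d where d: "longest d P Q" using assms mem_tree_intervals by blast
  have "Max ((\<lambda>Ps. length Ps - 1) ` tamari_chains (tree_path P) (tree_path Q)) = d"
  proof (rule Max_eqI[OF finite_tamari_chain_lengths])
    show "d \<in> (\<lambda>Ps. length Ps - 1) ` tamari_chains (tree_path P) (tree_path Q)"
      using tamari_chain_of_rotations[OF longest_rotations[OF d]] by force
  next
    fix m assume "m \<in> (\<lambda>Ps. length Ps - 1) ` tamari_chains (tree_path P) (tree_path Q)"
    then obtain Ps where Ps: "m = length Ps - 1" "Ps \<noteq> []" "hd Ps = tree_path P"
      "last Ps = tree_path Q" "set Ps \<subseteq> Collect dyck" "successively tamari_less Ps"
      by (auto simp: tamari_chains_def dyck_paths_def)
    then show "m \<le> d"
      using rotations_of_tamari_chain[of Ps] d unfolding longest_iff by fastforce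
  qed
  then show ?thesis using rotation_dist_eq[OF d] by (simp add: tamari_dist_def)
qed


section \<open>Contacts and maximal Dyck prefixes\<close>

lemma contacts_tree_path: "contacts (tree_path T) = lspine T"
proof (induction T)
  case (Node L x R)
  let ?bal = "\<lambda>D k. count_list (take k D) True = count_list (take k D) False"
  define A B where "A = tree_path L" and "B = tree_path R"
  have dA: "dyck A" and dB: "dyck B" by (auto simp: A_def B_def dyck_tree_path)
  have tot: "count_list A True = count_list A False" using dA by (simp add: dyck_def)
  have "{k. k < length (A @ True # B @ [False]) \<and> ?bal (A @ True # B @ [False]) k} =
    insert (length A) {k. k < length A \<and> ?bal A k}" (is "?S = ?T")
  proof (intro equalityI subsetI)
    fix k assume k: "k \<in> ?S"
    \<comment> \<open>Beyond \<open>length A\<close> the up-step keeps the path at positive height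
      until its end point, which \<open>k < length\<close> leaves out.\<close>
    have "k \<le> length A"
    proof (rule ccontr)
      assume "\<not> k \<le> length A"
      then obtain m where m: "k = length A + Suc m" by (metis add_Suc_right less_iff_Suc_add not_le)
      have "count_list (take m B) False \<le> count_list (take m B) True"
        by (rule dyck_prefixD[of _ "drop m B"]) (simp add: dB)
      moreover have "m \<le> length B" using k m by simp
      ultimately show False using k m tot by simp
    qed
    then show "k \<in> ?T" using k by (cases "k = length A") auto
  qed (use tot in auto)
  then have "contacts (A @ True # B @ [False]) = card ?T" by (simp add: contacts_def)
  also have "\<dots> = Suc (contacts A)" by (simp add: contacts_def)
  finally show ?case using Node by (simp add: A_def B_def)
qed (simp add: contacts_def)

text \<open>The down-step after \<open>D\<close> falls below the base height, so no longer prefix is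
  a Dyck path.\<close>

lemma max_dyck_prefix_append_False:
  assumes "dyck D"
  shows "max_dyck_prefix (D @ False # w) = D"
proof -
  have tot: "count_list D True = count_list D False" using assms by (simp add: dyck_def)
  have "Max {m. m \<le> length (D @ False # w) \<and> dyck (take m (D @ False # w))} = length D"
  proof (rule Max_eqI)
    fix m assume "m \<in> {m. m \<le> length (D @ False # w) \<and> dyck (take m (D @ False # w))}"
    then have m: "dyck (take m (D @ False # w))" by simp
    show "m \<le> length D"
    proof (rule ccontr)
      assume "\<not> m \<le> length D"
      then obtain i where "m = length D + Suc i" by (metis add_Suc_right less_iff_Suc_add not_le)
      then have "dyck ((D @ [False]) @ take i w)" using m by simp
      from dyck_prefixD[OF this] tot show False by simp
    qed
  qed (use assms in auto)
  then show ?thesis by (simp add: max_dyck_prefix_def)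
qed

section \<open>Multisets of statistics collected after each step\<close>

fun after_steps :: "bool \<Rightarrow> (path \<Rightarrow> nat) \<Rightarrow> path \<Rightarrow> nat multiset" where
  "after_steps s f [] = {#}"
| "after_steps s f (b # w) = (if b = s then {#f w#} else {#}) + after_steps s f w"

lemma step_positions_Cons:
  "step_positions s (b # w) = (if b = s then [0] else []) @ map Suc (step_positions s w)"
proof -
  have "[0..<length (b # w)] = 0 # map Suc [0..<length w]"
    unfolding map_Suc_upt by (simp add: upt_rec)
  then show ?thesis
    unfolding step_positions_def by (simp only: filter.simps filter_map) (simp add: comp_def)
qed

lemma length_step_positions: "length (step_positions s D) = count_list D s"
  by (induction D) (auto simp: step_positions_Cons step_positions_def[of s "[]"])

lemma count_list_after_last_step:
  "count_list D s > 0 \<Longrightarrow> count_list (after_step s (count_list D s) D) s = 0"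
proof (induction D)
  case (Cons b w)
  show ?case
  proof (cases "count_list w s > 0")
    case True
    then have "after_step s (count_list (b # w) s) (b # w) = after_step s (count_list w s) w"
      by (auto simp: after_step_def step_positions_Cons length_step_positions nth_append nth_Cons')
    then show ?thesis using True Cons.IH by simp
  next
    case False
    then have "b = s" using Cons.prems by (auto split: if_splits)
    then show ?thesis using False by (simp add: after_step_def step_positions_Cons)
  qed
qed simp

lemma after_steps_positions:
  "after_steps s f D = mset (map (\<lambda>k. f (drop (Suc k) D)) (step_positions s D))"
proof (induction D)
  case (Cons b w)
  then show ?case by (auto simp: step_positions_Cons comp_def)
qed (simp add: step_positions_def)

lemma after_steps_eq:
  "after_steps s f D = image_mset (\<lambda>i. f (after_step s i D)) (mset_set {1..count_list D s})"
proof -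
  let ?p = "step_positions s D"
  let ?g = "\<lambda>k. f (drop (Suc k) D)"
  have "map ?g ?p = map (\<lambda>i. ?g (?p ! i)) [0..<length ?p]"
    by (rule nth_equalityI) auto
  also have "mset \<dots> = image_mset (\<lambda>i. ?g (?p ! i)) (mset_set {0..<length ?p})"
    by simp
  \<comment> \<open>\<open>after_step\<close> counts from 1, positions in the list from 0.\<close>
  also have "\<dots> = image_mset (\<lambda>i. f (after_step s i D)) (image_mset Suc (mset_set {0..<length ?p}))"
    by (simp add: after_step_def multiset.map_comp comp_def)
  also have "image_mset Suc (mset_set {0..<length ?p}) = mset_set {1..length ?p}"
    by (subst image_mset_mset_set) (auto simp: image_Suc_atLeastLessThan atLeastLessThanSuc_atLeastAtMost)
  finally show ?thesis by (simp add: after_steps_positions length_step_positions)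
qed

text \<open>The last step of either kind has statistic \<open>0\<close>, which the monomials leave out.\<close>

lemma after_steps_minus_0:
  assumes "n = count_list D s" "n > 0" "f (after_step s n D) = 0"
  shows "image_mset (\<lambda>i. f (after_step s i D)) (mset_set {1..n - 1}) = after_steps s f D - {#0#}"
proof -
  have "{1..n} = insert n {1..n - 1}" using assms by auto
  moreover have "n \<notin> {1..n - 1}" using assms(2) by auto
  ultimately show ?thesis using assms by (simp add: after_steps_eq)
qed

text \<open>The word after an up-step runs past its subtree, hence the general suffix
  \<open>w\<close>; the matching down-step cuts off the maximal Dyck prefix.\<close>

lemma after_steps_contacts:
  "after_steps True (\<lambda>w. contacts (max_dyck_prefix w)) (tree_path T @ w) =
     lspines T + after_steps True (\<lambda>w. contacts (max_dyck_prefix w)) w"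
proof (induction T arbitrary: w)
  case (Node L x R)
  show ?case
    by (simp add: Node.IH max_dyck_prefix_append_False dyck_tree_path contacts_tree_path)
qed simp

lemma rises_append_False: "rises (v @ False # w) = rises v"
  by (induction v) (auto simp: rises_def)

lemma after_steps_rises:
  "after_steps False rises (v @ False # w) =
     add_mset (rises w) (after_steps False rises v + after_steps False rises w)"
  by (induction v) (auto simp: rises_append_False)

text \<open>\<open>T\<^sub>1\<close> is nested right after the first up-step, so the initial rise
  follows first children.\<close>

lemma rises_up_first: "rises (tree_path (up_first T)) = lspine T"
proof (induction T)
  case (Node T\<^sub>1 j T\<^sub>2)
  have "rises (tree_path (up_first (Node T\<^sub>1 j T\<^sub>2))) = Suc (rises (tree_path (up_first T\<^sub>1)))"
    using rises_append_False[of "tree_path (up_first T\<^sub>1)"] by (simp add: tree_path_cat rises_def)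
  then show ?case using Node by simp
qed (simp add: rises_def)

text \<open>The down-step closing a node is followed by the path of its right subtree, whose initial
  rise is a left spine.\<close>

lemma after_steps_rises_up_first:
  "after_steps False rises (tree_path (up_first T)) = lspines T"
  by (induction T) (auto simp: tree_path_cat after_steps_rises rises_up_first)


lemma contact_mon_tree_path:
  "contact_mon (tree_path T) X = X (lspine T) * prod_mset (image_mset X (lspines T - {#0#}))"
proof (cases "T = Leaf")
  case False
  let ?f = "\<lambda>w. contacts (max_dyck_prefix w)"
  let ?D = "tree_path T"
  define n where "n = count_list ?D True"
  have n: "n = path_size ?D" by (simp add: n_def path_size_def)
  then have "n = size T" by simp
  then have "n > 0" using False by (cases T) auto
  define w where "w = after_step True n ?D"
  have w: "count_list w True = 0"
    using count_list_after_last_step \<open>n > 0\<close> unfolding w_def n_def by blast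
  \<comment> \<open>After the last up-step only down-steps remain, so the only Dyck prefix is
    empty.\<close>
  have "m = 0" if "m \<le> length w" "dyck (take m w)" for m
  proof -
    have "count_list (take m w) True \<le> count_list w True"
      by (metis append_take_drop_id count_list_append le_add1)
    then have "length (take m w) = 0"
      using that w count_list_bool_length[of "take m w"] by (simp add: dyck_def)
    then show ?thesis using that by simp
  qed
  then have "{m. m \<le> length w \<and> dyck (take m w)} = {0}" by (auto simp: dyck_def)
  then have "?f w = 0" by (simp add: max_dyck_prefix_def contacts_def)
  then have "image_mset (\<lambda>i. contacts_at i ?D) (mset_set {1..n - 1}) = lspines T - {#0#}"
    using after_steps_minus_0[of n ?D True ?f] \<open>n > 0\<close> after_steps_contacts[of T "[]"]
    unfolding contacts_at_def w_def n_def by simp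
  moreover have "(\<Prod>i = 1..n - 1. X (contacts_at i ?D)) =
    prod_mset (image_mset X (image_mset (\<lambda>i. contacts_at i ?D) (mset_set {1..n - 1})))"
    by (simp add: prod_unfold_prod_mset multiset.map_comp comp_def)
  ultimately show ?thesis by (simp only: contact_mon_def n contacts_tree_path)
qed (simp add: contact_mon_def contacts_def path_size_def)

lemma rise_mon_eq:
  assumes "dyck D"
  shows "rise_mon D Y = Y (rises D) * prod_mset (image_mset Y (after_steps False rises D - {#0#}))"
proof (cases "D = []")
  case False
  define n where "n = count_list D False"
  have n: "n = path_size D" using assms by (simp add: n_def path_size_def dyck_def)
  have "length D = 2 * n" using assms count_list_bool_length[of D] by (simp add: n_def dyck_def)
  then have "n > 0" using False by (cases D) auto
  define w where "w = after_step False n D"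
  have w: "count_list w False = 0"
    using count_list_after_last_step \<open>n > 0\<close> unfolding w_def n_def by blast
  obtain v where v: "D = v @ w"
    unfolding w_def after_step_def by (metis append_take_drop_id)
  \<comment> \<open>\<open>w\<close> has no down-steps and \<open>v\<close> ends at height at least
    0, so balance leaves no up-step in \<open>w\<close> either.\<close>
  have "count_list v False \<le> count_list v True" using assms v dyck_prefixD by blast
  moreover have "count_list v True + count_list w True = count_list v False"
    using assms w unfolding dyck_def v by simp
  ultimately have "length w = 0" using w count_list_bool_length[of w] by linarith
  then have "rises w = 0" by (simp add: rises_def)
  then have "image_mset (\<lambda>i. rises_at i D) (mset_set {1..n - 1}) = after_steps False rises D - {#0#}"
    using after_steps_minus_0[of n D False rises] \<open>n > 0\<close>
    unfolding rises_at_def w_def n_def by simp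
  moreover have "(\<Prod>i = 1..n - 1. Y (rises_at i D)) =
    prod_mset (image_mset Y (image_mset (\<lambda>i. rises_at i D) (mset_set {1..n - 1})))"
    by (simp add: prod_unfold_prod_mset multiset.map_comp comp_def)
  ultimately show ?thesis by (simp only: rise_mon_def n)
qed (simp add: rise_mon_def path_size_def)


section \<open>The symmetry\<close>

text \<open>Passing to flow trees by the first encoding and back by the last one keeps lower
  contacts and distance, and trades rises of the upper bound for contacts of its mirror
  image.\<close>

lemma sum_tamari_intervals:
  fixes x y q :: "'a :: comm_ring_1"
  shows "(\<Sum>(D\<^sub>1, D\<^sub>2)\<in>tamari_intervals n.
      x ^ contacts D\<^sub>1 * y ^ rises D\<^sub>2 * contact_mon D\<^sub>1 X * rise_mon D\<^sub>2 Y * q ^ tamari_dist (D\<^sub>1, D\<^sub>2)) =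
    (\<Sum>(P, Q)\<in>tree_intervals n.
      x ^ lspine P * y ^ lspine (mirror Q) * contact_mon (tree_path P) X *
      contact_mon (tree_path (mirror Q)) Y * q ^ rotation_dist P Q)"
    (is "?lhs = ?rhs")
proof -
  let ?mon = "\<lambda>X c C. X c * prod_mset (image_mset X (C - {#0#}))"
  let ?w = "\<lambda>T. x ^ out T * y ^ lspine T * ?mon X (out T) (absorbed T) *
    ?mon Y (lspine T) (lspines T) * q ^ sum_labels T"
  have "?lhs = (\<Sum>(P, Q)\<in>tree_intervals n.
      x ^ lspine P * y ^ rises (tree_path Q) * contact_mon (tree_path P) X *
      rise_mon (tree_path Q) Y * q ^ rotation_dist P Q)"
    by (subst sum.reindex_bij_betw[OF bij_betw_tree_path, symmetric])
       (auto intro!: sum.cong simp: contacts_tree_path tamari_dist_tree_path)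
  also have "\<dots> = (\<Sum>T\<in>flow_trees n. ?w T)"
    by (subst sum.reindex_bij_betw[OF bij_betw_first, symmetric])
       (auto intro!: sum.cong simp: flow_trees_def contact_mon_tree_path rise_mon_eq dyck_tree_path
         lspine_low_first lspines_low_first rises_up_first after_steps_rises_up_first
         rotation_dist_eq[OF longest_first])
  also have "\<dots> = ?rhs"
    by (subst sum.reindex_bij_betw[OF bij_betw_last, symmetric])
       (auto intro!: sum.cong simp: flow_trees_def contact_mon_tree_path lspine_low_last
         lspines_low_last lspine_up_last lspines_up_last rotation_dist_eq[OF longest_last])
  finally show ?thesis .
qed

lemma Phi_symmetric: "Phi x y X Y q = Phi y x Y X q"
proof -
  \<comment> \<open>Both bounds now enter through contacts, so mirroring the interval exchanges
    their roles.\<close>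
  have "(\<Sum>(P, Q)\<in>tree_intervals n.
      x ^ lspine P * y ^ lspine (mirror Q) * contact_mon (tree_path P) X *
      contact_mon (tree_path (mirror Q)) Y * q ^ rotation_dist P Q) =
    (\<Sum>(P, Q)\<in>tree_intervals n.
      y ^ lspine P * x ^ lspine (mirror Q) * contact_mon (tree_path P) Y *
      contact_mon (tree_path (mirror Q)) X * q ^ rotation_dist P Q)" for n
    by (subst sum.reindex_bij_betw[OF bij_betw_mirror, symmetric])
       (auto intro!: sum.cong simp: rotation_dist_mirror mult_ac)
  then show ?thesis by (simp only: Phi_def sum_tamari_intervals)
qed

theorem theorem3p4:
  shows "Phi (Var Ind_x) (Var Ind_y) (\<lambda>i. Var (Ind_X i)) (\<lambda>i. Var (Ind_Y i)) (Var Ind_q)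
       = Phi (Var Ind_y) (Var Ind_x) (\<lambda>i. Var (Ind_Y i)) (\<lambda>i. Var (Ind_X i)) (Var Ind_q)"
  by (rule Phi_symmetric)

end
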